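(* Let $\mathcal{A},\mathcal{B}\in\mathbb{C}^{I_1\times\cdots\times I_N\times I_1\times\cdots\times I_N}$, and let $\mathcal{M},\mathcal{N}\in\mathbb{C}^{I_1\times\cdots\times I_N\times I_1\times\cdots\times I_N}$ be Hermitian positive definite tensors. If $$\mathcal{A}*_N(\mathcal{B}*_N\mathcal{B}^{\dagger}_{\mathcal{M}\mathcal{N}})=(\mathcal{B}*_N\mathcal{B}^{\dagger}_{\mathcal{M}\mathcal{N}})*_N\mathcal{A},$$ $$\mathcal{A}^{\dagger}_{\mathcal{M}\mathcal{N}}*_N(\mathcal{B}*_N\mathcal{B}^{\dagger}_{\mathcal{M}\mathcal{N}})=(\mathcal{B}*_N\mathcal{B}^{\dagger}_{\mathcal{M}\mathcal{N}})*_N\mathcal{A}^{\dagger}_{\mathcal{M}\mathcal{N}},$$ $$\mathcal{B}*_N(\mathcal{A}^{\dagger}_{\mathcal{M}\mathcal{N}}*_N\mathcal{A})=(\mathcal{A}^{\dagger}_{\mathcal{M}\mathcal{N}}*_N\mathcal{A})*_N\mathcal{B},$$ $$\mathcal{B}^{\dagger}_{\mathcal{M}\mathcal{N}}*_N(\mathcal{A}^{\dagger}_{\mathcal{M}\mathcal{N}}*_N\mathcal{A})=(\mathcal{A}^{\dagger}_{\mathcal{M}\mathcal{N}}*_N\mathcal{A})*_N\mathcal{B}^{\dagger}_{\mathcal{M}\mathcal{N}},$$ then $(\mathcal{A}*_N\mathcal{B})^{\dagger}_{\mathcal{M}\mathcal{N}}=\mathcal{B}^{\dagger}_{\mathcal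{M}\mathcal{N}}*_N\mathcal{A}^{\dagger}_{\mathcal{M}\mathcal{N}}$.
   Context: For tensors $\mathcal{A},\mathcal{B}\in\mathbb{C}^{I_1\times\cdots\times I_N\times I_1\times\cdots\times I_N}$ the Einstein product is $(\mathcal{A}*_N\mathcal{B})_{i_1\cdots i_Nk_1\cdots k_N}=\sum_{j_1,\dots,j_N}a_{i_1\cdots i_Nj_1\cdots j_N}b_{j_1\cdots j_Nk_1\cdots k_N}$. The conjugate transpose is $(\mathcal{A}^H)_{j_1\cdots j_Ni_1\cdots i_N}=\overline{a_{i_1\cdots i_Nj_1\cdots j_N}}$. The identity tensor $\mathcal{I}$ has entries $\prod_{k}\delta_{i_kj_k}$; $\mathcal{U}$ is unitary if $\mathcal{U}*_N\mathcal{U}^H=\mathcal{U}^H*_N\mathcal{U}=\mathcal{I}$; $\mathcal{D}$ is diagonal if $d_{i_1\cdots i_Nj_1\cdots j_N}=0$ whenever $(i_1,\dots,i_N)\ne(j_1,\dots,j_N)$. A tensor $\mathcal{P}$ is Hermitian positive definite if $\mathcal{P}=\mathcal{U}*_N\mathcal{D}*_N\mathcal{U}^H$ with $\mathcal{U}$ unitary and $\mathcal{D}$ diagonal with positive diagonal entries. For Hermitian positive definite $\mathcal{M},\mathcal{N}$, the weighted Moore--Penrose inverse $\mathcal{A}^{\dagger}_{\mathcal{M}\mathcal{N}}$ is the unique tensor $\mathcal{X}\in\mathbb{C}^{I_1\times\cdots\times I_N\times I_1\times\cdots\times I_N}$ satisfying $\mathcal{A}*_N\mathcal{X}*_N\mathcal{A}=\mathcal{A}$,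 $\mathcal{X}*_N\mathcal{A}*_N\mathcal{X}=\mathcal{X}$, $(\mathcal{M}*_N\mathcal{A}*_N\mathcal{X})^H=\mathcal{M}*_N\mathcal{A}*_N\mathcal{X}$, $(\mathcal{N}*_N\mathcal{X}*_N\mathcal{A})^H=\mathcal{N}*_N\mathcal{X}*_N\mathcal{A}$. *)

theory Defs
  imports Complex_Main
begin

text \<open>
  The list \<open>I = [I\<^sub>1, \<dots>, I\<^sub>N]\<close> carries both the order \<open>N = length I\<close> and the dimensions.
  A complex \<open>I\<^sub>1 \<times> \<dots> \<times> I\<^sub>N \<times> I\<^sub>1 \<times> \<dots> \<times> I\<^sub>N\<close> tensor is a function of two multi-indices, normalised
  to vanish outside the index range, so that equality of tensors is equality of functions.
\<close>

type_synonym tensor = "nat list \<Rightarrow> nat list \<Rightarrow> complex"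

definition multi_indices :: "nat list \<Rightarrow> nat list set" where
  "multi_indices I = listset (map (\<lambda>n. {1..n}) I)"

definition tensors :: "nat list \<Rightarrow> tensor set" where
  "tensors I = {A. \<forall>i j. i \<notin> multi_indices I \<or> j \<notin> multi_indices I \<longrightarrow> A i j = 0}"

definition einstein_prod :: "tensor \<Rightarrow> nat list \<Rightarrow> tensor \<Rightarrow> tensor"
    ("(_ *\<^bsub>_\<^esub> _)" [70, 0, 71] 70) where
  "A *\<^bsub>I\<^esub> B = (\<lambda>i k. \<Sum>j\<in>multi_indices I. A i j * B j k)"

definition conj_transpose :: "tensor \<Rightarrow> tensor" where
  "conj_transpose A = (\<lambda>j i. cnj (A i j))"

definition identity_tensor :: "nat list \<Rightarrow> tensor" where
  "identity_tensor I = (\<lambda>i j.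
     if i \<in> multi_indices I \<and> j \<in> multi_indices I
     then \<Prod>k<length I. if i ! k = j ! k then 1 else 0
     else 0)"

definition unitary_tensor :: "nat list \<Rightarrow> tensor \<Rightarrow> bool" where
  "unitary_tensor I U \<longleftrightarrow> U \<in> tensors I \<and>
     U *\<^bsub>I\<^esub> conj_transpose U = identity_tensor I \<and>
     conj_transpose U *\<^bsub>I\<^esub> U = identity_tensor I"

definition diagonal_tensor :: "nat list \<Rightarrow> tensor \<Rightarrow> bool" where
  "diagonal_tensor I D \<longleftrightarrow> D \<in> tensors I \<and>
     (\<forall>i\<in>multi_indices I. \<forall>j\<in>multi_indices I. i \<noteq> j \<longrightarrow> D i j = 0)"

definition hermitian_pos_def :: "nat list \<Rightarrow> tensor \<Rightarrow> bool" where
  "hermitian_pos_def I P \<longleftrightarrow> (\<exists>U D. unitary_tensor I U \<and> diagonal_tensor I D \<and>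
     (\<forall>i\<in>multi_indices I. \<exists>r>0. D i i = complex_of_real r) \<and>
     P = U *\<^bsub>I\<^esub> D *\<^bsub>I\<^esub> conj_transpose U)"

definition is_weighted_mp_inverse ::
    "nat list \<Rightarrow> tensor \<Rightarrow> tensor \<Rightarrow> tensor \<Rightarrow> tensor \<Rightarrow> bool" where
  "is_weighted_mp_inverse I M N A X \<longleftrightarrow> X \<in> tensors I \<and>
     A *\<^bsub>I\<^esub> X *\<^bsub>I\<^esub> A = A \<and>
     X *\<^bsub>I\<^esub> A *\<^bsub>I\<^esub> X = X \<and>
     conj_transpose (M *\<^bsub>I\<^esub> A *\<^bsub>I\<^esub> X) = M *\<^bsub>I\<^esub> A *\<^bsub>I\<^esub> X \<and>
     conj_transpose (N *\<^bsub>I\<^esub> X *\<^bsub>I\<^esub> A) = N *\<^bsub>I\<^esub> X *\<^bsub>I\<^esub> A"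

definition weighted_mp_inverse ::
    "nat list \<Rightarrow> tensor \<Rightarrow> tensor \<Rightarrow> tensor \<Rightarrow> tensor" where
  "weighted_mp_inverse I M N A = (THE X. is_weighted_mp_inverse I M N A X)"

end

theory Submission
  imports Defs "HOL-Library.Function_Algebras"
begin

text \<open>
  With a Hermitian weight \<open>M\<close>, call \<open>P\<close> self-adjoint if \<open>M P\<close> is Hermitian; the product of two
  commuting self-adjoint tensors is again self-adjoint. Hence the four commutation hypotheses make
  \<open>A B B\<^sup>\<dagger> A\<^sup>\<dagger> = (A A\<^sup>\<dagger>) (B B\<^sup>\<dagger>)\<close> and \<open>B\<^sup>\<dagger> A\<^sup>\<dagger> A B = (A\<^sup>\<dagger> A) (B\<^sup>\<dagger> B)\<close> self-adjoint for \<open>M\<close> and \<open>N\<close>, and the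
  Penrose equations for \<open>B\<^sup>\<dagger> A\<^sup>\<dagger>\<close> follow.

  Existence of the weighted inverse: if \<open>G\<close> is a generalised inverse of \<open>A\<^sup>H M A\<close>, then
  \<open>X = G A\<^sup>H M\<close> satisfies \<open>A X A = A\<close> with \<open>M A X\<close> Hermitian. Applied to \<open>A\<^sup>H\<close> with weight \<open>N\<^sup>-\<^sup>1\<close> this
  yields \<open>Y\<close> with \<open>A Y A = A\<close> and \<open>N Y A\<close> Hermitian, and \<open>Y A X\<close> is the weighted inverse.
\<close>

section \<open>Multi-indices, the identity tensor and conjugate transposition\<close>

lemma length_multi_indices: "i \<in> multi_indices I \<Longrightarrow> length i = length I"
  unfolding multi_indices_def
  by (induction I arbitrary: i) (auto simp: set_Cons_def)

lemma finite_multi_indices [simp]: "finite (multi_indices I)"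
  unfolding multi_indices_def
proof (induction I)
  case (Cons n I)
  have "listset (map (\<lambda>n. {1..n}) (n # I)) =
      case_prod (#) ` ({1..n} \<times> listset (map (\<lambda>n. {1..n}) I))"
    by (auto simp: set_Cons_def image_iff)
  then show ?case using Cons by simp
qed simp

text \<open>In-range multi-indices have equal length, so a product of deltas without a zero factor
  forces equality of the lists. In this form sums against the identity collapse to one term.\<close>

lemma identity_tensor_eq:
  "identity_tensor I i j = (if i \<in> multi_indices I \<and> i = j then 1 else 0)"
proof (cases "i \<in> multi_indices I \<and> j \<in> multi_indices I")
  case True
  then have len: "length i = length I" "length j = length I"
    by (auto dest: length_multi_indices)
  show ?thesis
  proof (cases "i = j")
    case False
    with len obtain k where "k < length I" "i ! k \<noteq> j ! k"
      by (metis nth_equalityI)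
    then have "(\<Prod>k<length I. if i ! k = j ! k then 1 else 0 :: complex) = 0"
      by (intro prod_zero) auto
    with False show ?thesis by (simp add: identity_tensor_def)
  qed (use True in \<open>simp add: identity_tensor_def\<close>)
qed (auto simp: identity_tensor_def)

lemma conj_transpose_conj_transpose [simp]: "conj_transpose (conj_transpose A) = A"
  by (simp add: conj_transpose_def)

lemma conj_transpose_tensors [simp]: "A \<in> tensors I \<Longrightarrow> conj_transpose A \<in> tensors I"
  by (auto simp: tensors_def conj_transpose_def)

section \<open>Algebra of the Einstein product over a fixed index range\<close>

context
  fixes I :: "nat list"
begin

abbreviation (input) eprod :: "tensor \<Rightarrow> tensor \<Rightarrow> tensor" (infixl "\<star>" 70) where
  "A \<star> B \<equiv> A *\<^bsub>I\<^esub> B"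

lemma einstein_assoc: "A \<star> B \<star> C = A \<star> (B \<star> C)"
proof (intro ext)
  fix i k
  have "(A \<star> B \<star> C) i k =
      (\<Sum>j\<in>multi_indices I. \<Sum>l\<in>multi_indices I. A i l * B l j * C j k)"
    by (simp add: einstein_prod_def sum_distrib_right)
  also have "\<dots> = (\<Sum>l\<in>multi_indices I. \<Sum>j\<in>multi_indices I. A i l * B l j * C j k)"
    by (rule sum.swap)
  also have "\<dots> = (A \<star> (B \<star> C)) i k"
    by (simp add: einstein_prod_def sum_distrib_left mult.assoc)
  finally show "(A \<star> B \<star> C) i k = (A \<star> (B \<star> C)) i k" .
qed

lemma conj_transpose_prod: "conj_transpose (A \<star> B) = conj_transpose B \<star> conj_transpose A"
  by (simp add: conj_transpose_def einstein_prod_def mult.commute)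

lemma einstein_tensors [simp]: "A \<in> tensors I \<Longrightarrow> B \<in> tensors I \<Longrightarrow> A \<star> B \<in> tensors I"
  by (auto simp: tensors_def einstein_prod_def)

lemma einstein_zero_right [simp]: "A \<star> (\<lambda>i k. 0) = (\<lambda>i k. 0)"
  by (simp add: einstein_prod_def)

lemma einstein_diff_right: "A \<star> (\<lambda>i k. B i k - C i k) = (\<lambda>i k. (A \<star> B) i k - (A \<star> C) i k)"
  by (simp add: einstein_prod_def right_diff_distrib sum_subtractf)

lemma identity_einstein [simp]:
  assumes "A \<in> tensors I"
  shows "identity_tensor I \<star> A = A"
proof (intro ext)
  fix i k
  have "(identity_tensor I \<star> A) i k = (\<Sum>j\<in>multi_indices I. if j = i then A i k else 0)"
    unfolding einstein_prod_def by (intro sum.cong) (auto simp: identity_tensor_eq)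
  then show "(identity_tensor I \<star> A) i k = A i k"
    using assms by (auto simp: tensors_def)
qed

lemma einstein_identity [simp]:
  assumes "A \<in> tensors I"
  shows "A \<star> identity_tensor I = A"
proof (intro ext)
  fix i k
  have "(A \<star> identity_tensor I) i k = (\<Sum>j\<in>multi_indices I. if j = k then A i k else 0)"
    unfolding einstein_prod_def by (intro sum.cong) (auto simp: identity_tensor_eq)
  then show "(A \<star> identity_tensor I) i k = A i k"
    using assms by (auto simp: tensors_def)
qed

section \<open>Hermitian positive definite tensors\<close>

lemma hermitian_pos_def_hermitian:
  assumes "hermitian_pos_def I M"
  shows "conj_transpose M = M"
proof -
  obtain U D where D: "diagonal_tensor I D"
    and pos: "\<forall>i\<in>multi_indices I. \<exists>r>0. D i i = complex_of_real r"
    and M: "M = U \<star> D \<star> conj_transpose U"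
    using assms unfolding hermitian_pos_def_def by blast
  have "cnj (D j i) = D i j" for i j
  proof (cases "i \<in> multi_indices I \<and> j \<in> multi_indices I")
    case True
    then show ?thesis
      using D pos by (cases "i = j") (force simp: diagonal_tensor_def)+
  next
    case False
    then have "D i j = 0" "D j i = 0"
      using D unfolding diagonal_tensor_def tensors_def by blast+
    then show ?thesis by simp
  qed
  then have "conj_transpose D = D"
    by (simp add: conj_transpose_def)
  then show ?thesis
    by (simp add: M conj_transpose_prod einstein_assoc)
qed

lemma hermitian_pos_def_tensors: "hermitian_pos_def I M \<Longrightarrow> M \<in> tensors I"
  by (auto simp: hermitian_pos_def_def unitary_tensor_def diagonal_tensor_def)

lemma diagonal_einstein:
  assumes "diagonal_tensor I D" "i \<in> multi_indices I"
  shows "(D \<star> A) i k = D i i * A i k"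
proof -
  have "(D \<star> A) i k = (\<Sum>j\<in>multi_indices I. if j = i then D i i * A i k else 0)"
    unfolding einstein_prod_def
    using assms by (intro sum.cong) (auto simp: diagonal_tensor_def)
  then show ?thesis using assms by simp
qed

text \<open>Inverting the eigenvalues in \<open>U D U\<^sup>H\<close> keeps them positive and gives
  the inverse.\<close>

lemma hermitian_pos_def_inverse:
  assumes "hermitian_pos_def I M"
  obtains M' where "hermitian_pos_def I M'" "M \<star> M' = identity_tensor I"
    "M' \<star> M = identity_tensor I"
proof -
  obtain U D where U: "unitary_tensor I U" and D: "diagonal_tensor I D"
    and pos: "\<forall>i\<in>multi_indices I. \<exists>r>0. D i i = complex_of_real r"
    and M: "M = U \<star> D \<star> conj_transpose U"
    using assms unfolding hermitian_pos_def_def by blast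
  \<comment> \<open>Since \<open>inverse 0 = 0\<close>, entrywise inversion keeps the zeros off the
    diagonal and outside the index range.\<close>
  define D' where "D' = (\<lambda>i j. inverse (D i j))"
  define M' where "M' = U \<star> D' \<star> conj_transpose U"
  have D': "diagonal_tensor I D'"
    using D by (auto simp: diagonal_tensor_def tensors_def D'_def)
  have nz: "D i i \<noteq> 0" if "i \<in> multi_indices I" for i
    using pos that by force
  have id: "E \<star> F = identity_tensor I"
    if E: "diagonal_tensor I E" and F: "diagonal_tensor I F"
      and EF: "\<And>i. i \<in> multi_indices I \<Longrightarrow> E i i * F i i = 1" for E F
  proof (intro ext)
    fix i k
    show "(E \<star> F) i k = identity_tensor I i k"
    proof (cases "i \<in> multi_indices I")
      case True
      have "F i k = 0" if "i \<noteq> k"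
        using F that True by (cases "k \<in> multi_indices I") (auto simp: diagonal_tensor_def tensors_def)
      then show ?thesis
        using True EF by (auto simp: diagonal_einstein [OF E] identity_tensor_eq)
    next
      case False
      then show ?thesis
        using E by (auto simp: einstein_prod_def identity_tensor_eq diagonal_tensor_def tensors_def)
    qed
  qed
  have DD': "D \<star> D' = identity_tensor I" "D' \<star> D = identity_tensor I"
    by (rule id [OF D D'], simp add: D'_def nz) (rule id [OF D' D], simp add: D'_def nz)
  have conj_prod: "U \<star> E \<star> conj_transpose U \<star> (U \<star> F \<star> conj_transpose U) = identity_tensor I"
    if "E \<in> tensors I" "F \<in> tensors I" "E \<star> F = identity_tensor I" for E F
  proof -
    have "U \<star> E \<star> conj_transpose U \<star> (U \<star> F \<star> conj_transpose U) =
        U \<star> (E \<star> (conj_transpose U \<star> U \<star> F)) \<star> conj_transpose U"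
      by (simp add: einstein_assoc)
    then show ?thesis
      using U that by (simp add: unitary_tensor_def)
  qed
  have "\<exists>r>0. D' i i = complex_of_real r" if i: "i \<in> multi_indices I" for i
  proof -
    obtain r where "r > 0" "D i i = complex_of_real r"
      using pos i by blast
    then show ?thesis
      by (intro exI [of _ "inverse r"]) (simp add: D'_def)
  qed
  then have "hermitian_pos_def I M'"
    using U D' unfolding hermitian_pos_def_def M'_def by blast
  moreover have "M \<star> M' = identity_tensor I" "M' \<star> M = identity_tensor I"
    using D D' DD' unfolding M M'_def by (auto intro!: conj_prod simp: diagonal_tensor_def)
  ultimately show thesis using that by blast
qed

text \<open>With \<open>F = U\<^sup>H E\<close>, the \<open>k\<close>-th diagonal entry of
  \<open>E\<^sup>H M E\<close> is the sum of \<open>r i * |F i k|\<^sup>2\<close>. Its terms are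
  nonnegative, so each vanishes, and \<open>E = U F\<close> is zero.\<close>

lemma hermitian_pos_def_definite:
  assumes "hermitian_pos_def I M" and E: "E \<in> tensors I"
    and zero: "conj_transpose E \<star> M \<star> E = (\<lambda>i k. 0)"
  shows "E = (\<lambda>i k. 0)"
proof -
  obtain U D where U: "unitary_tensor I U" and D: "diagonal_tensor I D"
    and pos: "\<forall>i\<in>multi_indices I. \<exists>r>0. D i i = complex_of_real r"
    and M: "M = U \<star> D \<star> conj_transpose U"
    using assms(1) unfolding hermitian_pos_def_def by blast
  obtain r where r: "r i > 0" "D i i = complex_of_real (r i)" if "i \<in> multi_indices I" for i
    using pos by metis
  define F where "F = conj_transpose U \<star> E"
  have FDF: "conj_transpose F \<star> (D \<star> F) = (\<lambda>i k. 0)"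
    using zero by (simp add: F_def M conj_transpose_prod einstein_assoc)
  have F0: "F i k = 0" if i: "i \<in> multi_indices I" for i k
  proof -
    have "complex_of_real (\<Sum>i\<in>multi_indices I. r i * (cmod (F i k))\<^sup>2) =
        (\<Sum>i\<in>multi_indices I. cnj (F i k) * (D \<star> F) i k)"
      unfolding of_real_sum
      by (intro sum.cong refl)
        (simp add: diagonal_einstein [OF D] r(2) complex_norm_square mult.commute
          mult.left_commute del: of_real_power)
    also have "\<dots> = (conj_transpose F \<star> (D \<star> F)) k k"
      unfolding einstein_prod_def [of "conj_transpose F"] by (simp add: conj_transpose_def)
    also have "\<dots> = 0" by (simp add: FDF)
    finally have "(\<Sum>i\<in>multi_indices I. r i * (cmod (F i k))\<^sup>2) = 0"
      by (simp only: of_real_eq_0_iff)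
    then have "r i * (cmod (F i k))\<^sup>2 = 0"
      using r(1) i by (subst (asm) sum_nonneg_eq_0_iff) (auto intro!: mult_nonneg_nonneg intro: less_imp_le)
    then show ?thesis using r(1) [OF i] by simp
  qed
  have "E = U \<star> F"
    using U E by (simp add: F_def unitary_tensor_def flip: einstein_assoc)
  also have "\<dots> = (\<lambda>i k. 0)"
    using F0 by (simp add: einstein_prod_def)
  finally show ?thesis .
qed

section \<open>Generalised inverses via linear maps\<close>

text \<open>A linear map on a vector space has a right inverse on its range; its matrix is \<open>G\<close>.\<close>

lemma generalised_inverse_exists:
  assumes A: "A \<in> tensors I"
  obtains G where "G \<in> tensors I" "A \<star> G \<star> A = A"
proof -
  \<comment> \<open>Pointwise scaling, with the pointwise addition of functions, makes all functions
    on lists a complex vector space.\<close>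
  define sc :: "complex \<Rightarrow> (nat list \<Rightarrow> complex) \<Rightarrow> nat list \<Rightarrow> complex"
    where "sc = (\<lambda>c v i. c * v i)"
  interpret vector_space_pair sc sc
    by unfold_locales (auto simp: sc_def fun_eq_iff algebra_simps)
  define f where "f = (\<lambda>v i. \<Sum>j\<in>multi_indices I. A i j * v j)"
  have "Vector_Spaces.linear sc sc f"
    by unfold_locales
      (auto simp: f_def sc_def fun_eq_iff algebra_simps sum.distrib sum_distrib_left)
  then obtain g where g: "Vector_Spaces.linear sc sc g" and fg: "\<And>v. f (g (f v)) = f v"
    using linear_exists_right_inverse_on [of f UNIV] by auto
  interpret g: Vector_Spaces.linear sc sc g by (rule g)
  define e where "e = (\<lambda>j i :: nat list. if i = j then 1 else 0 :: complex)"
  \<comment> \<open>The matrix of \<open>g\<close>, cut off to the index range. Values of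
    \<open>g\<close> outside the range are lost, so \<open>g_eq\<close> speaks only of
    \<open>i\<close> in range and of \<open>v\<close> supported there.\<close>
  define G where "G = (\<lambda>i j. if i \<in> multi_indices I \<and> j \<in> multi_indices I then g (e j) i else 0)"
  have sum_apply: "(\<Sum>j\<in>S. h j) i = (\<Sum>j\<in>S. h j i)"
    for h :: "nat list \<Rightarrow> nat list \<Rightarrow> complex" and S i
    by (induction S rule: infinite_finite_induct) auto
  have g_eq: "g v i = (\<Sum>j\<in>multi_indices I. G i j * v j)"
    if v: "\<And>j. j \<notin> multi_indices I \<Longrightarrow> v j = 0" and i: "i \<in> multi_indices I" for v i
  proof -
    have "v = (\<Sum>j\<in>multi_indices I. sc (v j) (e j))"
      using v by (auto simp: fun_eq_iff sum_apply sc_def e_def if_distrib [of "\<lambda>x. _ * x"]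
          cong: if_cong)
    then have "g v = g (\<Sum>j\<in>multi_indices I. sc (v j) (e j))"
      by (rule arg_cong)
    also have "\<dots> = (\<Sum>j\<in>multi_indices I. sc (v j) (g (e j)))"
      by (simp only: g.sum g.scale)
    finally have "g v i = (\<Sum>j\<in>multi_indices I. v j * g (e j) i)"
      by (simp add: sum_apply sc_def)
    also have "\<dots> = (\<Sum>j\<in>multi_indices I. G i j * v j)"
      using i by (intro sum.cong) (auto simp: G_def)
    finally show ?thesis .
  qed
  have "(A \<star> (G \<star> A)) i k = A i k" for i k
  proof -
    let ?a = "\<lambda>i. A i k"
    have a: "f (e k) = ?a" if "k \<in> multi_indices I"
      using that by (simp add: f_def e_def if_distrib [of "\<lambda>x. _ * x"] cong: if_cong)
    show ?thesis
    \<comment> \<open>For \<open>k\<close> in range, column \<open>k\<close> of \<open>A\<close> is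
      \<open>f (e k)\<close>, so \<open>fg\<close> applies to it; it is supported in the range, so
      \<open>G\<close> acts on it as \<open>g\<close> does.\<close>
    proof (cases "k \<in> multi_indices I")
      case True
      have "(A \<star> (G \<star> A)) i k = (\<Sum>j\<in>multi_indices I. A i j * g ?a j)"
        unfolding einstein_prod_def
        using A by (intro sum.cong refl arg_cong2 [of _ _ _ _ "(*)"] g_eq [symmetric])
          (auto simp: tensors_def)
      also have "\<dots> = f (g ?a) i" by (simp add: f_def)
      also have "\<dots> = A i k" using fg [of "e k"] a [OF True] by simp
      finally show ?thesis .
    next
      case False
      then show ?thesis using A by (simp add: tensors_def einstein_prod_def)
    qed
  qed
  then have "A \<star> G \<star> A = A" by (simp add: einstein_assoc fun_eq_iff)
  moreover have "G \<in> tensors I" by (auto simp: tensors_def G_def)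
  ultimately show thesis using that by blast
qed

section \<open>Hermiticity relative to a weight; existence and uniqueness of the weighted
  inverse\<close>

text \<open>Hermiticity of \<open>M P\<close> means \<open>P\<^sup>H M = M P\<close>, so
  \<open>M\<close> can be moved past both adjoints. Without a commutation hypothesis the statement
  also serves uniqueness, where the two products differ a priori.\<close>

lemma hermitian_weight_swap:
  assumes "conj_transpose M = M" "conj_transpose (M \<star> P) = M \<star> P" "conj_transpose (M \<star> Q) = M \<star> Q"
  shows "conj_transpose (M \<star> (P \<star> Q)) = M \<star> (Q \<star> P)"
proof -
  have P: "conj_transpose P \<star> M = M \<star> P" and Q: "conj_transpose Q \<star> M = M \<star> Q"
    using assms by (simp_all add: conj_transpose_prod)
  have "conj_transpose (M \<star> (P \<star> Q)) = conj_transpose Q \<star> (conj_transpose P \<star> M)"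
    using assms(1) by (simp add: conj_transpose_prod einstein_assoc)
  also have "\<dots> = conj_transpose Q \<star> M \<star> P"
    by (simp add: P einstein_assoc)
  also have "\<dots> = M \<star> (Q \<star> P)"
    by (simp add: Q einstein_assoc)
  finally show ?thesis .
qed

lemma hermitian_pos_def_cancel:
  assumes M: "hermitian_pos_def I M" and "A \<in> tensors I" "B \<in> tensors I"
    and "M \<star> A = M \<star> B"
  shows "A = B"
proof -
  obtain M' where "M' \<star> M = identity_tensor I"
    using hermitian_pos_def_inverse [OF M] by blast
  then show ?thesis
    by (metis assms(2-4) einstein_assoc identity_einstein)
qed

text \<open>\<open>X\<close> solves the normal equations
  \<open>A\<^sup>H M A X = A\<^sup>H M\<close> of the least squares problem weighted by
  \<open>M\<close>.\<close>

lemma least_squares_inverse_exists: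
  assumes M: "hermitian_pos_def I M" and A: "A \<in> tensors I"
  obtains X where "X \<in> tensors I" "A \<star> X \<star> A = A" "conj_transpose (M \<star> (A \<star> X)) = M \<star> (A \<star> X)"
proof -
  note MH = hermitian_pos_def_hermitian [OF M] and MT = hermitian_pos_def_tensors [OF M]
  define A' where "A' = conj_transpose A"
  have A': "A' \<in> tensors I" "conj_transpose A' = A" "conj_transpose A = A'"
    using A by (auto simp: A'_def)
  define H where "H = A' \<star> M \<star> A"
  have H: "H \<in> tensors I" "conj_transpose H = H"
    using A A' MT MH by (auto simp: H_def conj_transpose_prod einstein_assoc)
  obtain G where G: "G \<in> tensors I" "H \<star> G \<star> H = H"
    using generalised_inverse_exists H(1) by blast
  \<comment> \<open>\<open>G\<close> need not be Hermitian, but as \<open>H\<close> is,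
    \<open>G\<^sup>H\<close> is again a generalised inverse of \<open>H\<close>. The conjugate
    transpose of \<open>inv\<close> for \<open>G'\<close> yields the normal equations for
    \<open>G\<close>.\<close>
  define G' where "G' = conj_transpose G"
  have G': "G' \<in> tensors I" "H \<star> G' \<star> H = H" "conj_transpose G' = G"
    using G H by (auto simp: G'_def) (metis conj_transpose_prod einstein_assoc)
  have inv: "A \<star> K \<star> A' \<star> M \<star> A = A" if K: "K \<in> tensors I" "H \<star> K \<star> H = H" for K
  proof -
    define E where "E = (\<lambda>i k. (A \<star> K \<star> A' \<star> M \<star> A) i k - A i k)"
    have E: "E \<in> tensors I"
    proof -
      have "A \<star> K \<star> A' \<star> M \<star> A \<in> tensors I"
        using A A' K MT by simp
      then show ?thesis using A by (auto simp: E_def tensors_def)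
    qed
    have "A' \<star> M \<star> (A \<star> K \<star> A' \<star> M \<star> A) = H \<star> K \<star> H"
      by (simp add: H_def einstein_assoc)
    then have A'ME: "A' \<star> M \<star> E = (\<lambda>i k. 0)"
      using K(2) by (simp add: E_def einstein_diff_right H_def)
    define C where "C = (\<lambda>i k. (K \<star> A' \<star> M \<star> A) i k - identity_tensor I i k)"
    \<comment> \<open>The defect \<open>E\<close> lies in the range of \<open>A\<close> and
      satisfies \<open>A' M E = 0\<close>, so it is \<open>M\<close>-orthogonal to itself and
      definiteness applies.\<close>
    have "E = A \<star> C"
      using A by (simp add: E_def C_def einstein_diff_right einstein_assoc)
    then have "conj_transpose E \<star> M \<star> E = conj_transpose C \<star> (A' \<star> M \<star> E)"
      by (simp add: conj_transpose_prod einstein_assoc A')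
    then have "E = (\<lambda>i k. 0)"
      using A'ME by (intro hermitian_pos_def_definite [OF M E]) simp
    then show ?thesis by (simp add: E_def fun_eq_iff)
  qed
  define X where "X = G \<star> A' \<star> M"
  have "A' \<star> M \<star> A \<star> G \<star> A' = conj_transpose (A \<star> G' \<star> A' \<star> M \<star> A)"
    using MH by (simp add: conj_transpose_prod einstein_assoc A' G')
  also have "\<dots> = A'" using inv [OF G'(1,2)] A' by simp
  finally have "A' \<star> M \<star> A \<star> X = A' \<star> M"
    by (simp add: X_def flip: einstein_assoc)
  \<comment> \<open>The normal equations turn \<open>X\<^sup>H A' M\<close> into
    \<open>X\<^sup>H A' M A X\<close>, which is visibly Hermitian.\<close>
  then have "conj_transpose (M \<star> (A \<star> X)) = conj_transpose X \<star> (A' \<star> M \<star> A \<star> X)" (is "_ = ?T")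
    by (simp add: conj_transpose_prod einstein_assoc A' MH)
  moreover have "conj_transpose ?T = ?T"
    by (simp add: conj_transpose_prod einstein_assoc A' MH)
  ultimately have "conj_transpose (M \<star> (A \<star> X)) = M \<star> (A \<star> X)"
    by (metis conj_transpose_conj_transpose)
  moreover have "A \<star> X \<star> A = A"
    using inv [OF G] by (simp add: X_def einstein_assoc)
  moreover have "X \<in> tensors I" using G A' MT by (simp add: X_def)
  ultimately show thesis using that by blast
qed

lemma weighted_mp_inverse_exists:
  assumes M: "hermitian_pos_def I M" and N: "hermitian_pos_def I N" and A: "A \<in> tensors I"
  shows "\<exists>X. is_weighted_mp_inverse I M N A X"
proof -
  obtain X where X: "X \<in> tensors I" "A \<star> X \<star> A = A"
    "conj_transpose (M \<star> (A \<star> X)) = M \<star> (A \<star> X)"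
    using least_squares_inverse_exists [OF M A] .
  obtain N' where N': "hermitian_pos_def I N'" "N \<star> N' = identity_tensor I"
    "N' \<star> N = identity_tensor I"
    using hermitian_pos_def_inverse [OF N] .
  note NH = hermitian_pos_def_hermitian [OF N] hermitian_pos_def_hermitian [OF N'(1)]
  obtain Z where Z: "Z \<in> tensors I" "conj_transpose A \<star> Z \<star> conj_transpose A = conj_transpose A"
    "conj_transpose (N' \<star> (conj_transpose A \<star> Z)) = N' \<star> (conj_transpose A \<star> Z)"
    using least_squares_inverse_exists [OF N'(1), of "conj_transpose A"] A by auto
  define Y where "Y = conj_transpose Z"
  have Y: "Y \<in> tensors I" "A \<star> Y \<star> A = A"
    using Z(1) arg_cong [OF Z(2), of conj_transpose]
    by (simp_all add: Y_def conj_transpose_prod einstein_assoc)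
  have "Y \<star> A \<star> N' = N' \<star> (conj_transpose A \<star> Z)"
    using Z(3) by (simp add: Y_def conj_transpose_prod einstein_assoc NH)
  \<comment> \<open>Multiplying by \<open>N\<close> on both sides cancels \<open>N'\<close> and
    leaves \<open>N Y A = A\<^sup>H Z N\<close>, whose sides are conjugate transposes of each
    other.\<close>
  then have "N \<star> (Y \<star> A \<star> N') \<star> N = N \<star> N' \<star> (conj_transpose A \<star> Z) \<star> N"
    by (simp add: einstein_assoc)
  moreover have "N \<star> (Y \<star> A \<star> N') \<star> N = N \<star> (Y \<star> A)"
    using N'(3) Y A by (simp add: einstein_assoc)
  ultimately have "N \<star> (Y \<star> A) = conj_transpose A \<star> Z \<star> N"
    using N'(2) A Z by simp
  then have NYA: "conj_transpose (N \<star> (Y \<star> A)) = N \<star> (Y \<star> A)"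
    by (metis NH(1) Y_def conj_transpose_conj_transpose conj_transpose_prod)
  \<comment> \<open>\<open>W\<close> shares \<open>A W\<close> with \<open>X\<close> and
    \<open>W A\<close> with \<open>Y\<close>, so it inherits one Hermitian condition from
    each.\<close>
  define W where "W = Y \<star> A \<star> X"
  have AW: "A \<star> W = A \<star> X" and WA: "W \<star> A = Y \<star> A"
    using X Y by (simp_all add: W_def flip: einstein_assoc) (simp add: einstein_assoc)
  have "is_weighted_mp_inverse I M N A W"
    unfolding is_weighted_mp_inverse_def
  proof (intro conjI)
    show "W \<in> tensors I" using X Y A by (simp add: W_def)
    show "A \<star> W \<star> A = A" using AW X by simp
    show "W \<star> A \<star> W = W"
      using Y by (metis AW W_def WA einstein_assoc)
    show "conj_transpose (M \<star> A \<star> W) = M \<star> A \<star> W"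
      using X AW by (simp add: einstein_assoc)
    show "conj_transpose (N \<star> W \<star> A) = N \<star> W \<star> A"
      using NYA WA by (simp add: einstein_assoc)
  qed
  then show ?thesis by blast
qed

text \<open>The products of \<open>A X\<close> and \<open>A Y\<close> in either order collapse to
  one factor, so the swap lemma and cancellation of \<open>M\<close> give \<open>A X = A Y\<close>.
  Likewise \<open>X A = Y A\<close>, whence \<open>X = X A X = Y A X = Y A Y = Y\<close>.\<close>

lemma weighted_mp_inverse_unique:
  assumes M: "hermitian_pos_def I M" and N: "hermitian_pos_def I N" and A: "A \<in> tensors I"
    and X: "is_weighted_mp_inverse I M N A X" and Y: "is_weighted_mp_inverse I M N A Y"
  shows "X = Y"
proof -
  note MH = hermitian_pos_def_hermitian [OF M] and NH = hermitian_pos_def_hermitian [OF N]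
  have X': "X \<in> tensors I" "A \<star> X \<star> A = A" "X \<star> A \<star> X = X"
    "conj_transpose (M \<star> (A \<star> X)) = M \<star> (A \<star> X)" "conj_transpose (N \<star> (X \<star> A)) = N \<star> (X \<star> A)"
    using X by (auto simp: is_weighted_mp_inverse_def einstein_assoc)
  have Y': "Y \<in> tensors I" "A \<star> Y \<star> A = A" "Y \<star> A \<star> Y = Y"
    "conj_transpose (M \<star> (A \<star> Y)) = M \<star> (A \<star> Y)" "conj_transpose (N \<star> (Y \<star> A)) = N \<star> (Y \<star> A)"
    using Y by (auto simp: is_weighted_mp_inverse_def einstein_assoc)
  have "conj_transpose (M \<star> (A \<star> Y \<star> (A \<star> X))) = M \<star> (A \<star> X \<star> (A \<star> Y))"
    by (rule hermitian_weight_swap [OF MH Y'(4) X'(4)])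
  moreover have "A \<star> Y \<star> (A \<star> X) = A \<star> X" "A \<star> X \<star> (A \<star> Y) = A \<star> Y"
    using X' Y' by (simp_all flip: einstein_assoc)
  ultimately have "M \<star> (A \<star> X) = M \<star> (A \<star> Y)"
    using X' by simp
  then have AX: "A \<star> X = A \<star> Y"
    using hermitian_pos_def_cancel [OF M] A X'(1) Y'(1) einstein_tensors by blast
  have "conj_transpose (N \<star> (X \<star> A \<star> (Y \<star> A))) = N \<star> (Y \<star> A \<star> (X \<star> A))"
    by (rule hermitian_weight_swap [OF NH X'(5) Y'(5)])
  moreover have "X \<star> A \<star> (Y \<star> A) = X \<star> A" "Y \<star> A \<star> (X \<star> A) = Y \<star> A"
    using X' Y' by (simp_all add: einstein_assoc)
  ultimately have "N \<star> (X \<star> A) = N \<star> (Y \<star> A)"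
    using X' by simp
  then have XA: "X \<star> A = Y \<star> A"
    using hermitian_pos_def_cancel [OF N] A X'(1) Y'(1) einstein_tensors by blast
  show ?thesis
    by (metis AX XA X'(3) Y'(3) einstein_assoc)
qed

lemma weighted_mp_inverse_eq:
  assumes "hermitian_pos_def I M" "hermitian_pos_def I N" "A \<in> tensors I"
    and "is_weighted_mp_inverse I M N A X"
  shows "weighted_mp_inverse I M N A = X"
  unfolding weighted_mp_inverse_def
  using assms weighted_mp_inverse_unique by blast

text \<open>Existence and uniqueness together give the definite description its meaning.\<close>

lemma weighted_mp_inverse:
  assumes "hermitian_pos_def I M" "hermitian_pos_def I N" "A \<in> tensors I"
  shows "is_weighted_mp_inverse I M N A (weighted_mp_inverse I M N A)"
proof -
  obtain X where X: "is_weighted_mp_inverse I M N A X"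
    using weighted_mp_inverse_exists [OF assms] by blast
  then show ?thesis
    by (simp add: weighted_mp_inverse_eq [OF assms X])
qed

section \<open>The reverse order law\<close>

lemma is_weighted_mp_inverse_prod:
  assumes M: "hermitian_pos_def I M" and N: "hermitian_pos_def I N"
    and X: "is_weighted_mp_inverse I M N A X" and Y: "is_weighted_mp_inverse I M N B Y"
    and AP: "A \<star> (B \<star> Y) = (B \<star> Y) \<star> A" and XP: "X \<star> (B \<star> Y) = (B \<star> Y) \<star> X"
    and BQ: "B \<star> (X \<star> A) = (X \<star> A) \<star> B" and YQ: "Y \<star> (X \<star> A) = (X \<star> A) \<star> Y"
  shows "is_weighted_mp_inverse I M N (A \<star> B) (Y \<star> X)"
proof -
  have X': "X \<in> tensors I" "A \<star> X \<star> A = A" "X \<star> A \<star> X = X"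
    "conj_transpose (M \<star> (A \<star> X)) = M \<star> (A \<star> X)" "conj_transpose (N \<star> (X \<star> A)) = N \<star> (X \<star> A)"
    using X by (auto simp: is_weighted_mp_inverse_def einstein_assoc)
  have Y': "Y \<in> tensors I" "B \<star> Y \<star> B = B" "Y \<star> B \<star> Y = Y"
    "conj_transpose (M \<star> (B \<star> Y)) = M \<star> (B \<star> Y)" "conj_transpose (N \<star> (Y \<star> B)) = N \<star> (Y \<star> B)"
    using Y by (auto simp: is_weighted_mp_inverse_def einstein_assoc)
  \<comment> \<open>With \<open>C = A B\<close> and \<open>Z = Y X\<close>, each commutation
    hypothesis gives one factorisation: \<open>AP\<close> and \<open>XP\<close> show that
    \<open>A X\<close> and \<open>B Y\<close> commute with product \<open>C Z\<close>,
    \<open>YQ\<close> and \<open>BQ\<close> that \<open>X A\<close> and \<open>Y B\<close> commute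
    with product \<open>Z C\<close>.\<close>
  have "A \<star> B \<star> (Y \<star> X) = A \<star> (B \<star> Y) \<star> X"
    by (simp add: einstein_assoc)
  then have CZ: "A \<star> B \<star> (Y \<star> X) = B \<star> Y \<star> (A \<star> X)"
    by (simp add: AP einstein_assoc)
  have CZ': "A \<star> B \<star> (Y \<star> X) = A \<star> X \<star> (B \<star> Y)"
    by (metis XP einstein_assoc)
  have "Y \<star> X \<star> (A \<star> B) = Y \<star> (X \<star> A) \<star> B"
    by (simp add: einstein_assoc)
  then have ZC: "Y \<star> X \<star> (A \<star> B) = X \<star> A \<star> (Y \<star> B)"
    by (simp add: YQ einstein_assoc)
  have ZC': "Y \<star> X \<star> (A \<star> B) = Y \<star> B \<star> (X \<star> A)"
    by (metis BQ einstein_assoc)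
  have "A \<star> B \<star> (Y \<star> X) \<star> (A \<star> B) = B \<star> Y \<star> (A \<star> X \<star> A) \<star> B"
    unfolding CZ by (simp add: einstein_assoc)
  \<comment> \<open>Once \<open>A X A\<close> has become \<open>A\<close>, \<open>AP\<close> read
    backwards carries \<open>B Y\<close> across \<open>A\<close> to meet \<open>B\<close>.\<close>
  also have "\<dots> = A \<star> (B \<star> Y \<star> B)"
    unfolding X' AP [symmetric] by (simp add: einstein_assoc)
  finally have CZC: "A \<star> B \<star> (Y \<star> X) \<star> (A \<star> B) = A \<star> B"
    by (simp add: Y')
  have "Y \<star> X \<star> (A \<star> B) \<star> (Y \<star> X) = X \<star> A \<star> (Y \<star> B \<star> Y) \<star> X"
    unfolding ZC by (simp add: einstein_assoc)
  \<comment> \<open>Dually, \<open>YQ\<close> read backwards carries \<open>X A\<close> across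
    \<open>Y\<close> to meet \<open>X\<close>.\<close>
  also have "\<dots> = Y \<star> (X \<star> A \<star> X)"
    unfolding Y' YQ [symmetric] by (simp add: einstein_assoc)
  finally have ZCZ: "Y \<star> X \<star> (A \<star> B) \<star> (Y \<star> X) = Y \<star> X"
    by (simp add: X')
  \<comment> \<open>The swap lemma exchanges the two factorisations of \<open>C Z\<close>, which are
    equal.\<close>
  have "conj_transpose (M \<star> (A \<star> B \<star> (Y \<star> X))) = M \<star> (A \<star> B \<star> (Y \<star> X))"
    using hermitian_weight_swap [OF hermitian_pos_def_hermitian [OF M] Y'(4) X'(4)] CZ CZ' by simp
  moreover have "conj_transpose (N \<star> (Y \<star> X \<star> (A \<star> B))) = N \<star> (Y \<star> X \<star> (A \<star> B))"
    using hermitian_weight_swap [OF hermitian_pos_def_hermitian [OF N] Y'(5) X'(5)] ZC ZC' by simp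
  ultimately show ?thesis
    using X' Y' CZC ZCZ by (simp add: is_weighted_mp_inverse_def flip: einstein_assoc)
qed

end

theorem theorem4p1:
  fixes I :: "nat list" and A B M N :: tensor
  assumes "A \<in> tensors I" and "B \<in> tensors I"
    and "M \<in> tensors I" and "N \<in> tensors I"
    and "hermitian_pos_def I M" and "hermitian_pos_def I N"
    and "A *\<^bsub>I\<^esub> (B *\<^bsub>I\<^esub> weighted_mp_inverse I M N B) =
         (B *\<^bsub>I\<^esub> weighted_mp_inverse I M N B) *\<^bsub>I\<^esub> A"
    and "weighted_mp_inverse I M N A *\<^bsub>I\<^esub> (B *\<^bsub>I\<^esub> weighted_mp_inverse I M N B) =
         (B *\<^bsub>I\<^esub> weighted_mp_inverse I M N B) *\<^bsub>I\<^esub> weighted_mp_inverse I M N A"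
    and "B *\<^bsub>I\<^esub> (weighted_mp_inverse I M N A *\<^bsub>I\<^esub> A) =
         (weighted_mp_inverse I M N A *\<^bsub>I\<^esub> A) *\<^bsub>I\<^esub> B"
    and "weighted_mp_inverse I M N B *\<^bsub>I\<^esub> (weighted_mp_inverse I M N A *\<^bsub>I\<^esub> A) =
         (weighted_mp_inverse I M N A *\<^bsub>I\<^esub> A) *\<^bsub>I\<^esub> weighted_mp_inverse I M N B"
  shows "weighted_mp_inverse I M N (A *\<^bsub>I\<^esub> B) =
         weighted_mp_inverse I M N B *\<^bsub>I\<^esub> weighted_mp_inverse I M N A"
proof (rule weighted_mp_inverse_eq)
  show "is_weighted_mp_inverse I M N (A *\<^bsub>I\<^esub> B)
      (weighted_mp_inverse I M N B *\<^bsub>I\<^esub> weighted_mp_inverse I M N A)"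
    by (rule is_weighted_mp_inverse_prod [OF assms(5,6) weighted_mp_inverse weighted_mp_inverse
          assms(7-10)])
      (rule assms)+
qed (use assms in simp_all)

end
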